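(* Let $L$ be a real Leibniz algebra such that $L/I\cong\mathfrak{D}_{\mathbb{R}}$ and such that $I$, as a right $\mathfrak{D}_{\mathbb{R}}$-module, is the module with basis $\{X_1,X_2,X_3,X_4\}$ and action (omitted products are zero) $$\begin{array}{lll} (X_1,P_1)=X_2, & (X_1,P_2)=X_3, & (X_1,T)=2X_4,\\ (X_2,J)=-X_3, & (X_2,P_2)=X_4, & \\ (X_3,J)=X_2, & (X_3,P_1)=-X_4. & \end{array}$$ Then there exist $\alpha_1,\alpha_2\in\mathbb{R}$ and a basis $\{J,P_1,P_2,T,X_1,X_2,X_3,X_4\}$ of $L$ in which the table of multiplication is (omitted products are zero) $$L(\alpha_1,\alpha_2):\quad\begin{array}{ll} [J,P_1]=P_2, & [P_1,J]=-P_2,\\ [J,P_2]=-P_1, & [P_2,J]=P_1,\\ [P_1,P_2]=T, & [P_2,P_1]=-T,\\ [J,J]=\alpha_1X_4, & [P_1,P_1]=\alpha_2X_1,\\ [P_2,P_2]=\alpha_2X_1, & [J,T]=2\alpha_2X_1,\\ [P_1,T]=-2\alpha_2X_3, & [T,P_1]=3\alpha_2X_3,\\ [P_2,T]=2\alpha_2X_2, & [T,P_2]=-3\alpha_2X_2,\\ [X_1,P_1]=X_2, & [X_1,P_2]=X_3,\\ [X_1,T]=2X_4, & [X_2,J]=-X_3,\\ [X_2,P_2]=X_4, & [X_3,J]=X_2,\\ [X_3,P_1]=-X_4. & \end{array}$$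
   Context: A Leibniz algebra over a field is a vector space $L$ with a bilinear product $[-,-]$ satisfying $[x,[y,z]]=[[x,y],z]-[[x,z],y]$ for all $x,y,z\in L$. For a Leibniz algebra $L$, $I$ denotes the ideal generated by the squares $[x,x]$, $x\in L$; it is contained in the right annihilator of $L$ (i.e. $[y,a]=0$ for all $y\in L$, $a\in I$). The quotient $\overline{L}=L/I$ is a Lie algebra, called the corresponding Lie algebra of $L$, and $I$ is a right $\overline{L}$-module via $(a,\overline{x})\mapsto[a,x]$. Right modules over a Lie algebra satisfy $(m,[x,y])=((m,x),y)-((m,y),x)$. The real Diamond Lie algebra $\mathfrak{D}_{\mathbb{R}}$ is the four-dimensional real Lie algebra with basis $\{J,P_1,P_2,T\}$ and nonzero brackets (up to antisymmetry) $[J,P_1]=P_2$, $[J,P_2]=-P_1$, $[P_1,P_2]=T$. *)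

theory Defs
  imports "HOL-Analysis.Analysis"
begin

definition leibniz_algebra :: "('a::real_vector \<Rightarrow> 'a \<Rightarrow> 'a) \<Rightarrow> bool" where
  "leibniz_algebra br \<longleftrightarrow> bilinear br \<and>
     (\<forall>x y z. br x (br y z) = br (br x y) z - br (br x z) y)"

definition leibniz_ideal :: "('a::real_vector \<Rightarrow> 'a \<Rightarrow> 'a) \<Rightarrow> 'a set \<Rightarrow> bool" where
  "leibniz_ideal br S \<longleftrightarrow> subspace S \<and> (\<forall>a\<in>S. \<forall>x. br a x \<in> S \<and> br x a \<in> S)"

definition squares_ideal :: "('a::real_vector \<Rightarrow> 'a \<Rightarrow> 'a) \<Rightarrow> 'a set" where
  "squares_ideal br = \<Inter>{S. leibniz_ideal br S \<and> (\<forall>x. br x x \<in> S)}"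

lemma leibniz_ideal_squares_ideal: "leibniz_ideal br (squares_ideal br)"
  unfolding leibniz_ideal_def squares_ideal_def
  by (auto intro!: subspace_Inter)

text \<open>
  The quotient by \<open>S\<close> consists of the cosets of \<open>S\<close>. Its operations are defined on arbitrary sets
  of vectors; the lemmas below show that on cosets they are given by representatives.
\<close>

definition coset :: "'a::real_vector set \<Rightarrow> 'a \<Rightarrow> 'a set" where
  "coset S x = {x + s | s. s \<in> S}"

definition quot_add :: "'a::real_vector set \<Rightarrow> 'a set \<Rightarrow> 'a set \<Rightarrow> 'a set" where
  "quot_add S A B = {a + b + s | a b s. a \<in> A \<and> b \<in> B \<and> s \<in> S}"

definition quot_scale :: "'a::real_vector set \<Rightarrow> real \<Rightarrow> 'a set \<Rightarrow> 'a set" where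
  "quot_scale S c A = {c *\<^sub>R a + s | a s. a \<in> A \<and> s \<in> S}"

definition quot_bracket ::
    "('a::real_vector \<Rightarrow> 'a \<Rightarrow> 'a) \<Rightarrow> 'a set \<Rightarrow> 'a set \<Rightarrow> 'a set \<Rightarrow> 'a set" where
  "quot_bracket br S A B = {br a b + s | a b s. a \<in> A \<and> b \<in> B \<and> s \<in> S}"

lemma coset_self: "subspace S \<Longrightarrow> x \<in> coset S x"
  unfolding coset_def by (auto intro!: exI[of _ 0] simp: subspace_0)

lemma quot_add_coset:
  assumes "subspace S"
  shows "quot_add S (coset S x) (coset S y) = coset S (x + y)"
proof (intro set_eqI iffI)
  fix z assume "z \<in> quot_add S (coset S x) (coset S y)"
  then obtain s t u where "z = x + y + (s + t + u)" "s \<in> S" "t \<in> S" "u \<in> S"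
    by (auto simp: quot_add_def coset_def algebra_simps)
  then show "z \<in> coset S (x + y)"
    using assms by (auto simp: coset_def subspace_add)
next
  fix z assume "z \<in> coset S (x + y)"
  then show "z \<in> quot_add S (coset S x) (coset S y)"
    using coset_self[OF assms] unfolding quot_add_def coset_def[of S "x + y"] by blast
qed

lemma quot_scale_coset:
  assumes "subspace S"
  shows "quot_scale S c (coset S x) = coset S (c *\<^sub>R x)"
proof (intro set_eqI iffI)
  fix z assume "z \<in> quot_scale S c (coset S x)"
  then obtain s t where "z = c *\<^sub>R x + (c *\<^sub>R s + t)" "s \<in> S" "t \<in> S"
    by (auto simp: quot_scale_def coset_def algebra_simps)
  then show "z \<in> coset S (c *\<^sub>R x)"
    using assms by (auto simp: coset_def subspace_add subspace_scale)
next
  fix z assume "z \<in> coset S (c *\<^sub>R x)"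
  then show "z \<in> quot_scale S c (coset S x)"
    using coset_self[OF assms] unfolding quot_scale_def coset_def[of S "c *\<^sub>R x"] by blast
qed

lemma quot_bracket_coset:
  assumes "bilinear br" and S: "leibniz_ideal br S"
  shows "quot_bracket br S (coset S x) (coset S y) = coset S (br x y)"
proof (intro set_eqI iffI)
  have sub: "subspace S" using S by (simp add: leibniz_ideal_def)
  {
    fix z assume "z \<in> quot_bracket br S (coset S x) (coset S y)"
    then obtain s t u where z: "z = br (x + s) (y + t) + u" and st: "s \<in> S" "t \<in> S" "u \<in> S"
      by (auto simp: quot_bracket_def coset_def)
    have "z = br x y + (br x t + br s (y + t) + u)"
      using assms(1) z by (simp add: bilinear_ladd bilinear_radd)
    moreover have "br x t + br s (y + t) + u \<in> S"
      using S st sub by (auto simp: leibniz_ideal_def intro!: subspace_add)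
    ultimately show "z \<in> coset S (br x y)"
      by (auto simp: coset_def)
  next
    fix z assume "z \<in> coset S (br x y)"
    then show "z \<in> quot_bracket br S (coset S x) (coset S y)"
      using coset_self[OF sub] unfolding quot_bracket_def coset_def[of S "br x y"] by blast
  }
qed

definition quot_algebra_iso ::
    "('a::real_vector \<Rightarrow> 'a \<Rightarrow> 'a) \<Rightarrow> 'a set \<Rightarrow> ('b::real_vector \<Rightarrow> 'b \<Rightarrow> 'b) \<Rightarrow> ('a set \<Rightarrow> 'b) \<Rightarrow> bool"
  where
  "quot_algebra_iso br S br' \<phi> \<longleftrightarrow>
     bij_betw \<phi> (range (coset S)) UNIV \<and>
     (\<forall>A\<in>range (coset S). \<forall>B\<in>range (coset S). \<phi> (quot_add S A B) = \<phi> A + \<phi> B) \<and>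
     (\<forall>c. \<forall>A\<in>range (coset S). \<phi> (quot_scale S c A) = c *\<^sub>R \<phi> A) \<and>
     (\<forall>A\<in>range (coset S). \<forall>B\<in>range (coset S). \<phi> (quot_bracket br S A B) = br' (\<phi> A) (\<phi> B))"

datatype diamond_ix = J | P1 | P2 | T

lemma UNIV_diamond_ix: "(UNIV :: diamond_ix set) = {J, P1, P2, T}"
  using diamond_ix.exhaust by auto

instance diamond_ix :: finite
  by standard (simp add: UNIV_diamond_ix)

type_synonym diamond = "real ^ diamond_ix"

definition diamond_table :: "diamond_ix \<Rightarrow> diamond_ix \<Rightarrow> diamond" where
  "diamond_table i j = (case (i, j) of
       (J, P1) \<Rightarrow> axis P2 1
     | (P1, J) \<Rightarrow> - axis P2 1
     | (J, P2) \<Rightarrow> - axis P1 1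
     | (P2, J) \<Rightarrow> axis P1 1
     | (P1, P2) \<Rightarrow> axis T 1
     | (P2, P1) \<Rightarrow> - axis T 1
     | _ \<Rightarrow> 0)"

definition diamond_bracket :: "diamond \<Rightarrow> diamond \<Rightarrow> diamond" where
  "diamond_bracket u v = (\<Sum>i\<in>UNIV. \<Sum>j\<in>UNIV. (u $ i * v $ j) *\<^sub>R diamond_table i j)"

datatype mod_ix = X1 | X2 | X3 | X4

lemma UNIV_mod_ix: "(UNIV :: mod_ix set) = {X1, X2, X3, X4}"
  using mod_ix.exhaust by auto

instance mod_ix :: finite
  by standard (simp add: UNIV_mod_ix)

type_synonym diamond_mod = "real ^ mod_ix"

definition act_table :: "mod_ix \<Rightarrow> diamond_ix \<Rightarrow> diamond_mod" where
  "act_table i j = (case (i, j) of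
       (X1, P1) \<Rightarrow> axis X2 1
     | (X1, P2) \<Rightarrow> axis X3 1
     | (X1, T) \<Rightarrow> 2 *\<^sub>R axis X4 1
     | (X2, J) \<Rightarrow> - axis X3 1
     | (X2, P2) \<Rightarrow> axis X4 1
     | (X3, J) \<Rightarrow> axis X2 1
     | (X3, P1) \<Rightarrow> - axis X4 1
     | _ \<Rightarrow> 0)"

definition diamond_act :: "diamond_mod \<Rightarrow> diamond \<Rightarrow> diamond_mod" where
  "diamond_act m u = (\<Sum>i\<in>UNIV. \<Sum>j\<in>UNIV. (m $ i * u $ j) *\<^sub>R act_table i j)"

text \<open>
  \<open>S\<close> is regarded as a right module over the Diamond algebra by transporting the action
  \<open>(a, coset S x) \<mapsto> br a x\<close> of the quotient along \<open>\<phi>\<close>; the map \<open>\<psi>\<close> is an isomorphism onto it.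
\<close>

definition diamond_module_iso ::
    "('a::real_vector \<Rightarrow> 'a \<Rightarrow> 'a) \<Rightarrow> 'a set \<Rightarrow> ('a set \<Rightarrow> diamond) \<Rightarrow> (diamond_mod \<Rightarrow> 'a) \<Rightarrow> bool"
  where
  "diamond_module_iso br S \<phi> \<psi> \<longleftrightarrow>
     linear \<psi> \<and> bij_betw \<psi> UNIV S \<and>
     (\<forall>m x. \<psi> (diamond_act m (\<phi> (coset S x))) = br (\<psi> m) x)"

definition is_basis :: "('i \<Rightarrow> 'a::real_vector) \<Rightarrow> bool" where
  "is_basis e \<longleftrightarrow> inj e \<and> independent (range e) \<and> span (range e) = UNIV"

datatype leib_ix = D diamond_ix | M mod_ix

definition leib_table :: "real \<Rightarrow> real \<Rightarrow> (leib_ix \<Rightarrow> 'a::real_vector) \<Rightarrow> leib_ix \<Rightarrow> leib_ix \<Rightarrow> 'a"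
  where
  "leib_table \<alpha>1 \<alpha>2 e i j = (case (i, j) of
       (D J, D P1) \<Rightarrow> e (D P2)
     | (D P1, D J) \<Rightarrow> - e (D P2)
     | (D J, D P2) \<Rightarrow> - e (D P1)
     | (D P2, D J) \<Rightarrow> e (D P1)
     | (D P1, D P2) \<Rightarrow> e (D T)
     | (D P2, D P1) \<Rightarrow> - e (D T)
     | (D J, D J) \<Rightarrow> \<alpha>1 *\<^sub>R e (M X4)
     | (D P1, D P1) \<Rightarrow> \<alpha>2 *\<^sub>R e (M X1)
     | (D P2, D P2) \<Rightarrow> \<alpha>2 *\<^sub>R e (M X1)
     | (D J, D T) \<Rightarrow> (2 * \<alpha>2) *\<^sub>R e (M X1)
     | (D P1, D T) \<Rightarrow> (- 2 * \<alpha>2) *\<^sub>R e (M X3)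
     | (D T, D P1) \<Rightarrow> (3 * \<alpha>2) *\<^sub>R e (M X3)
     | (D P2, D T) \<Rightarrow> (2 * \<alpha>2) *\<^sub>R e (M X2)
     | (D T, D P2) \<Rightarrow> (- 3 * \<alpha>2) *\<^sub>R e (M X2)
     | (M X1, D P1) \<Rightarrow> e (M X2)
     | (M X1, D P2) \<Rightarrow> e (M X3)
     | (M X1, D T) \<Rightarrow> 2 *\<^sub>R e (M X4)
     | (M X2, D J) \<Rightarrow> - e (M X3)
     | (M X2, D P2) \<Rightarrow> e (M X4)
     | (M X3, D J) \<Rightarrow> e (M X2)
     | (M X3, D P1) \<Rightarrow> - e (M X4)
     | _ \<Rightarrow> 0)"

end

theory Submission
  imports Defs
begin

text \<open>
  Since \<open>[L, I] = 0\<close>, changing a lift of \<open>J\<close> or \<open>P1\<close> by an element of \<open>I\<close> affects brackets only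
  through the left factor. Adjust the lift of \<open>J\<close> so that \<open>[J, J]\<close> has no \<open>X2\<close>- and
  \<open>X3\<close>-components, and then take \<open>P2 = [J, P]\<close>, \<open>P1 = - [J, P2]\<close>, \<open>T = [P1, P2]\<close> for a lift \<open>P\<close>
  of \<open>P1\<close>. The Leibniz identity forces \<open>[J, J] = \<alpha>1 X4\<close> and
  \<open>[P1, P1] = [P2, P2] = \<alpha>2 X1 + \<epsilon> X4\<close>. Repeating the construction from \<open>J - \<epsilon> X1\<close> replaces
  \<open>P1\<close> by \<open>P1 + \<epsilon> X3\<close>, which kills \<open>\<epsilon>\<close>; the remaining brackets are then forced.
\<close>

section \<open>Preliminaries: indexed families, the right annihilator, tables on basis
  vectors\<close>

text \<open>\<open>is_basis\<close> asks for injectivity of the family besides independence of its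
  range; the coefficient criterion over indices yields both.\<close>

lemma independent_family_if_scalars_zero:
  fixes e :: "'i \<Rightarrow> 'a::real_vector"
  assumes fin: "finite I"
    and zero: "\<And>c i. (\<Sum>i\<in>I. c i *\<^sub>R e i) = 0 \<Longrightarrow> i \<in> I \<Longrightarrow> c i = 0"
  shows "inj_on e I" and "independent (e ` I)"
proof -
  show inj: "inj_on e I"
  proof (rule inj_onI, rule ccontr)
    fix i j assume ij: "i \<in> I" "j \<in> I" "e i = e j" "i \<noteq> j"
    \<comment> \<open>These are the coefficients of the nontrivial relation
      \<open>e i - e j = 0\<close>.\<close>
    define c :: "'i \<Rightarrow> real" where "c k = of_bool (k = i) - of_bool (k = j)" for k
    have "(\<Sum>k\<in>I. c k *\<^sub>R e k)
        = (\<Sum>k\<in>I. if k = i then e k else 0) - (\<Sum>k\<in>I. if k = j then e k else 0)"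
      unfolding sum_subtractf[symmetric] by (rule sum.cong) (auto simp: c_def)
    also have "\<dots> = 0" using fin ij by simp
    finally have "c i = 0" using zero ij(1) by blast
    with ij(4) show False by (simp add: c_def)
  qed
  show "independent (e ` I)"
  proof (rule independent_if_scalars_zero)
    show "finite (e ` I)" using fin by simp
    fix f x assume f: "(\<Sum>x\<in>e ` I. f x *\<^sub>R x) = 0" and "x \<in> e ` I"
    then obtain i where "i \<in> I" "x = e i" by blast
    moreover have "(\<Sum>i\<in>I. f (e i) *\<^sub>R e i) = 0"
      using f by (simp add: sum.reindex[OF inj])
    ultimately show "f x = 0" using zero[of "\<lambda>i. f (e i)"] by blast
  qed
qed

text \<open>The right annihilator is an ideal, by
  \<open>[y, [a, x]] = [[y, a], x] - [[y, x], a]\<close>. It contains all squares, because the two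
  terms of \<open>[y, [x, x]]\<close> cancel, so it contains the smallest such ideal.\<close>

lemma squares_ideal_right_annihilator:
  assumes L: "leibniz_algebra br" and a: "a \<in> squares_ideal br"
  shows "br y a = 0"
proof -
  have bil: "bilinear br"
    and leib: "\<And>x y z. br x (br y z) = br (br x y) z - br (br x z) y"
    using L by (auto simp: leibniz_algebra_def)
  have "leibniz_ideal br {a. \<forall>y. br y a = 0}"
    unfolding leibniz_ideal_def subspace_def
    by (auto simp: bilinear_radd[OF bil] bilinear_rmul[OF bil] bilinear_rzero[OF bil]
        bilinear_lzero[OF bil] leib)
  moreover have "\<forall>x. br x x \<in> {a. \<forall>y. br y a = 0}"
    by (simp add: leib)
  ultimately show ?thesis
    using a unfolding squares_ideal_def by blast
qed

lemma diamond_bracket_axis [simp]: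
  "diamond_bracket (axis i 1) (axis j 1) = diamond_table i j"
  by (cases i; cases j) (simp_all add: diamond_bracket_def UNIV_diamond_ix axis_def)

lemma axis_component: "axis i x $ j = (if j = i then x else 0)"
  by (simp add: axis_def)

lemma diamond_act_axis:
  "diamond_act m (axis j 1) = (\<Sum>i\<in>UNIV. m $ i *\<^sub>R act_table i j)"
  by (cases j) (simp_all add: diamond_act_def UNIV_diamond_ix axis_def)

lemma vec_mod_ix_expand:
  "(m :: diamond_mod) = m $ X1 *\<^sub>R axis X1 1 + m $ X2 *\<^sub>R axis X2 1
     + m $ X3 *\<^sub>R axis X3 1 + m $ X4 *\<^sub>R axis X4 1"
  unfolding vec_eq_iff by (rule allI, rule mod_ix.exhaust) (auto simp: axis_def)

lemma UNIV_leib_ix: "(UNIV :: leib_ix set) = range D \<union> range M"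
  using leib_ix.exhaust by blast

lemma sum_leib_ix: "(\<Sum>i\<in>UNIV. f i) = (\<Sum>i\<in>UNIV. f (D i)) + (\<Sum>i\<in>UNIV. f (M i))"
proof -
  have "(\<Sum>i\<in>UNIV. f i) = sum f (range D) + sum f (range M)"
    unfolding UNIV_leib_ix by (rule sum.union_disjoint) auto
  also have "\<dots> = (\<Sum>i\<in>UNIV. f (D i)) + (\<Sum>i\<in>UNIV. f (M i))"
    by (simp add: sum.reindex inj_on_def)
  finally show ?thesis .
qed

section \<open>The extension of the Diamond algebra by I, and coordinates on I\<close>

text \<open>The data form a short exact sequence with kernel inclusion \<open>\<psi>\<close> and
  projection \<open>\<pi>\<close>; this keeps cosets out of the bracket computations.\<close>

locale diamond_extension =
  fixes br :: "'a::real_vector \<Rightarrow> 'a \<Rightarrow> 'a"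
    and \<pi> :: "'a \<Rightarrow> diamond"
    and \<psi> :: "diamond_mod \<Rightarrow> 'a"
  assumes leibniz_algebra: "leibniz_algebra br"
    and linear_proj: "linear \<pi>" and surj_proj: "surj \<pi>"
    and proj_br: "\<pi> (br x y) = diamond_bracket (\<pi> x) (\<pi> y)"
    and linear_incl: "linear \<psi>" and inj_incl: "inj \<psi>"
    and range_incl: "range \<psi> = {x. \<pi> x = 0}"
    and incl_act: "\<psi> (diamond_act m (\<pi> x)) = br (\<psi> m) x"
    and br_incl_right: "br y (\<psi> m) = 0"
begin

lemma bil: "bilinear br"
  and leibniz: "br x (br y z) = br (br x y) z - br (br x z) y"
  using leibniz_algebra by (auto simp: leibniz_algebra_def)

lemmas br_simps =
  bilinear_ladd[OF bil] bilinear_radd[OF bil] bilinear_lneg[OF bil] bilinear_rneg[OF bil]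
  bilinear_lsub[OF bil] bilinear_rsub[OF bil] bilinear_lmul[OF bil] bilinear_rmul[OF bil]
  bilinear_lzero[OF bil] bilinear_rzero[OF bil]

lemmas proj_simps =
  linear_add[OF linear_proj] linear_diff[OF linear_proj] linear_neg[OF linear_proj]
  linear_scale[OF linear_proj] linear_0[OF linear_proj]

text \<open>Coordinates on I with respect to X1, X2, X3, X4: an equation in I becomes four real
  equations that the simplifier can split.\<close>

definition q :: "real \<Rightarrow> real \<Rightarrow> real \<Rightarrow> real \<Rightarrow> 'a" where
  "q a b c d = \<psi> (a *\<^sub>R axis X1 1 + b *\<^sub>R axis X2 1 + c *\<^sub>R axis X3 1 + d *\<^sub>R axis X4 1)"

lemma incl_eq_q: "\<psi> m = q (m $ X1) (m $ X2) (m $ X3) (m $ X4)"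
  unfolding q_def by (subst vec_mod_ix_expand) (rule refl)

lemma kernelE:
  assumes "\<pi> x = 0"
  obtains a b c d where "x = q a b c d"
proof -
  have "x \<in> range \<psi>" using assms range_incl by simp
  then show ?thesis using that incl_eq_q by blast
qed

lemma q_inject [simp]: "q a b c d = q a' b' c' d' \<longleftrightarrow> a = a' \<and> b = b' \<and> c = c' \<and> d = d'"
proof
  assume "q a b c d = q a' b' c' d'"
  then have *: "a *\<^sub>R axis X1 1 + b *\<^sub>R axis X2 1 + c *\<^sub>R axis X3 1 + d *\<^sub>R axis X4 1
     = a' *\<^sub>R axis X1 1 + b' *\<^sub>R axis X2 1 + c' *\<^sub>R axis X3 1 + d' *\<^sub>R (axis X4 1 :: diamond_mod)"
    unfolding q_def using inj_incl by (simp add: inj_eq)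
  show "a = a' \<and> b = b' \<and> c = c' \<and> d = d'"
    using arg_cong[OF *, of "\<lambda>v. v $ X1"] arg_cong[OF *, of "\<lambda>v. v $ X2"]
      arg_cong[OF *, of "\<lambda>v. v $ X3"] arg_cong[OF *, of "\<lambda>v. v $ X4"]
    by (simp add: axis_def)
qed auto

lemma q_add [simp]: "q a b c d + q a' b' c' d' = q (a + a') (b + b') (c + c') (d + d')"
  unfolding q_def linear_add[OF linear_incl, symmetric] by (simp add: algebra_simps)

lemma q_minus [simp]: "- q a b c d = q (- a) (- b) (- c) (- d)"
  unfolding q_def linear_neg[OF linear_incl, symmetric] by (simp add: algebra_simps)

lemma q_diff [simp]: "q a b c d - q a' b' c' d' = q (a - a') (b - b') (c - c') (d - d')"
  unfolding q_def linear_diff[OF linear_incl, symmetric] by (simp add: algebra_simps)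

lemma q_scale [simp]: "r *\<^sub>R q a b c d = q (r * a) (r * b) (r * c) (r * d)"
  unfolding q_def linear_scale[OF linear_incl, symmetric] by (simp add: algebra_simps)

lemma q_0 [simp]: "q 0 0 0 0 = 0"
  by (simp add: q_def linear_0[OF linear_incl])

lemma q_eq_0_iff [simp]: "q a b c d = 0 \<longleftrightarrow> a = 0 \<and> b = 0 \<and> c = 0 \<and> d = 0"
  using q_inject[of a b c d 0 0 0 0] by simp

lemma incl_axis: "\<psi> (axis X1 1) = q 1 0 0 0" "\<psi> (axis X2 1) = q 0 1 0 0"
  "\<psi> (axis X3 1) = q 0 0 1 0" "\<psi> (axis X4 1) = q 0 0 0 1"
  by (simp_all add: q_def)

lemma proj_q [simp]: "\<pi> (q a b c d) = 0"
  unfolding q_def using range_incl by blast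

lemma br_q_right [simp]: "br y (q a b c d) = 0"
  unfolding q_def by (rule br_incl_right)

text \<open>By \<open>incl_act\<close> the right action on I sees only the image under
  \<open>\<pi>\<close>, so the module table holds for every lift.\<close>

lemma br_q_left:
  "\<pi> x = axis J 1 \<Longrightarrow> br (q a b c d) x = q 0 c (- b) 0"
  "\<pi> x = axis P1 1 \<Longrightarrow> br (q a b c d) x = q 0 a 0 (- c)"
  "\<pi> x = axis P2 1 \<Longrightarrow> br (q a b c d) x = q 0 0 a b"
  "\<pi> x = axis T 1 \<Longrightarrow> br (q a b c d) x = q 0 0 0 (2 * a)"
  unfolding q_def incl_act[symmetric]
  by (simp_all add: diamond_act_axis UNIV_mod_ix act_table_def axis_component mult.commute)

section \<open>Lifts of J, P1, P2 and T\<close>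

text \<open>Defining \<open>p2\<close> and \<open>p1\<close> by brackets with \<open>j\<close>
  removes all error terms from \<open>[j, p1]\<close> and \<open>[j, p2]\<close>. Leibniz identities
  then give linear equations for the errors in the other brackets. The lift \<open>p\<close> is
  arbitrary so that the construction can be repeated.\<close>

lemma adapted_lifts:
  assumes pJ: "\<pi> j = axis J 1" and pP: "\<pi> p = axis P1 1"
    and jj: "br j j = q a 0 0 d"
    and p2: "p2 = br j p" and p1: "p1 = - br j p2" and t: "t = br p1 p2"
  shows "\<pi> p1 = axis P1 1" "\<pi> p2 = axis P2 1" "\<pi> t = axis T 1"
    and "br j p1 = p2" "br j p2 = - p1" "br p1 j = - p2" "br p2 j = p1"
    and "br p2 p1 = - t" "br t j = 0" "br j j = q 0 0 0 d"
    and "\<exists>b \<epsilon>. br p1 p1 = q b 0 0 \<epsilon> \<and> br p2 p2 = q b 0 0 \<epsilon>"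
proof -
  show pp2: "\<pi> p2 = axis P2 1" using pJ pP by (simp add: p2 proj_br diamond_table_def)
  show pp1: "\<pi> p1 = axis P1 1"
    using pJ pp2 by (simp add: p1 proj_br proj_simps diamond_table_def)
  show pt: "\<pi> t = axis T 1" using pp1 pp2 by (simp add: t proj_br diamond_table_def)
  note act = br_q_left(1)[OF pJ] br_q_left(2)[OF pp1] br_q_left(3)[OF pp2] br_q_left(4)[OF pt]
  show jp2: "br j p2 = - p1" by (simp add: p1)
  \<comment> \<open>Two lifts of P1 differ by an element of I, which is invisible in the right
    factor.\<close>
  have "\<pi> (p - p1) = 0" using pP pp1 by (simp add: proj_simps)
  then obtain k1 k2 k3 k4 where "p = p1 + q k1 k2 k3 k4"
    by (metis kernelE add.commute diff_add_cancel)
  then show jp1: "br j p1 = p2" by (simp add: p2 br_simps)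
  have p2j: "br p2 j = p1 + q 0 a 0 0"
    using leibniz[of j j p1] by (simp add: jp1 jp2 jj act algebra_simps)
  have p1j: "br p1 j = - p2 - q 0 0 a 0"
    using leibniz[of j j p2] by (simp add: jp1 jp2 jj act br_simps algebra_simps)
  have "\<pi> (br p1 p1) = 0" "\<pi> (br p2 p2) = 0" "\<pi> (br p2 p1 + t) = 0"
    using pp1 pp2 pt by (simp_all add: proj_br proj_simps diamond_table_def)
  then obtain b1 b2 b3 b4 c1 c2 c3 c4 d1 d2 d3 d4 where
    b: "br p1 p1 = q b1 b2 b3 b4" and c: "br p2 p2 = q c1 c2 c3 c4"
    and "br p2 p1 + t = q d1 d2 d3 d4"
    by (metis kernelE)
  then have d: "br p2 p1 = - t + q d1 d2 d3 d4" by (simp add: algebra_simps)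
  \<comment> \<open>The error of \<open>[p2, p1]\<close> is computed twice; comparing X4-coordinates
    gives \<open>a = - a\<close>.\<close>
  have 1: "q d1 d2 d3 d4 = q 0 (- b3) b2 a"
    using leibniz[of p1 j p1] by (simp add: jp1 p1j b act br_simps d t[symmetric] algebra_simps)
  have 2: "q d1 d2 d3 d4 = q 0 c3 (- c2) (- a)"
    using leibniz[of p2 j p2] by (simp add: jp2 p2j c act br_simps d t[symmetric] algebra_simps)
  from 1 2 have a0: "a = 0" and d': "d1 = 0" "d2 = - b3" "d3 = b2" "d4 = 0"
    and c': "c2 = - b2" "c3 = - b3" by auto
  have "br t j = br p1 p1 - br p2 p2"
    using leibniz[of p1 j p2] by (simp add: jp2 p1j a0 br_simps t[symmetric] algebra_simps)
  then have tj: "br t j = q (b1 - c1) (b2 - c2) (b3 - c3) (b4 - c4)"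
    by (simp add: b c)
  \<comment> \<open>After substituting the relations found so far, the X2- and X3-coordinates read
    \<open>3 * b2 = 0\<close> and \<open>3 * b3 = 0\<close>.\<close>
  have 3: "q c1 c2 c3 c4 = q b1 b2 b3 b4 + (br t j - q 0 d3 (- d2) 0)"
    using leibniz[of p2 j p1]
    by (simp add: jp1 p2j b c d a0 act br_simps algebra_simps)
  from 3 tj c' d' have z: "b2 = 0" "b3 = 0" "c1 = b1" "c4 = b4" by auto
  show "br p1 j = - p2" "br p2 j = p1" using p1j p2j a0 by simp_all
  show "br p2 p1 = - t" using d d' z by simp
  show "br t j = 0" using tj c' z by simp
  show "br j j = q 0 0 0 d" using jj a0 by simp
  show "\<exists>b \<epsilon>. br p1 p1 = q b 0 0 \<epsilon> \<and> br p2 p2 = q b 0 0 \<epsilon>"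
    using b c c' z by simp
qed

lemma normalized_lifts:
  obtains j p1 p2 t \<alpha> \<beta> where
    "\<pi> j = axis J 1" "\<pi> p1 = axis P1 1" "\<pi> p2 = axis P2 1" "\<pi> t = axis T 1"
    "br j p1 = p2" "br j p2 = - p1" "br p1 j = - p2" "br p2 j = p1"
    "br p1 p2 = t" "br p2 p1 = - t" "br t j = 0" "br j j = q 0 0 0 \<alpha>"
    "br p1 p1 = q \<beta> 0 0 0" "br p2 p2 = q \<beta> 0 0 0"
proof -
  obtain j0 p where j0: "\<pi> j0 = axis J 1" and p: "\<pi> p = axis P1 1"
    using surj_proj by (metis surjD)
  have "\<pi> (br j0 j0) = 0" using j0 by (simp add: proj_br diamond_table_def)
  then obtain a1 a2 a3 a4 where a: "br j0 j0 = q a1 a2 a3 a4" by (rule kernelE)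
  \<comment> \<open>J rotates the plane of X2 and X3:
    \<open>[a3 X2 - a2 X3, J] = - a2 X2 - a3 X3\<close>, which cancels the unwanted part of
    \<open>[j0, j0]\<close>.\<close>
  define j where "j = j0 + q 0 a3 (- a2) 0"
  have pj: "\<pi> j = axis J 1" using j0 by (simp add: j_def proj_simps)
  have "br j j = q a1 0 0 a4"
    by (simp add: j_def br_simps a br_q_left(1)[OF j0])
  note A = adapted_lifts[OF pj p this refl refl refl]
  define p2 where "p2 = br j p"
  define p1 where "p1 = - br j p2"
  note A = A[folded p2_def, folded p1_def]
  obtain b \<epsilon> where b: "br p1 p1 = q b 0 0 \<epsilon>" "br p2 p2 = q b 0 0 \<epsilon>" using A(11) by blast
  \<comment> \<open>Since \<open>[X1, J] = 0\<close>, this change leaves \<open>[j, j]\<close>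
    alone, while X1 acts on lifts of P1 and P2 and so shifts \<open>p2\<close> and \<open>p1\<close>
    along X2 and X3.\<close>
  define j' where "j' = j + q (- \<epsilon>) 0 0 0"
  have pj': "\<pi> j' = axis J 1" using pj by (simp add: j'_def proj_simps)
  have "br j' j' = q 0 0 0 a4"
    by (simp add: j'_def br_simps A(10) br_q_left(1)[OF pj])
  note B = adapted_lifts[OF pj' A(1) this refl refl refl]
  define p2' where "p2' = br j' p1"
  define p1' where "p1' = - br j' p2'"
  note B = B[folded p2'_def, folded p1'_def]
  have "p2' = p2 + q 0 (- \<epsilon>) 0 0"
    by (simp add: p2'_def j'_def br_simps A(4) br_q_left(2)[OF A(1)])
  then have "p1' = p1 + q 0 0 \<epsilon> 0"
    by (simp add: p1'_def j'_def br_simps A(5) br_q_left(3)[OF A(2)])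
  \<comment> \<open>\<open>[X3, P1] = - X4\<close>, so the shift by \<open>\<epsilon>\<close> X3
    contributes exactly \<open>- \<epsilon>\<close> X4.\<close>
  then have b': "br p1' p1' = q b 0 0 0"
    by (simp add: br_simps b br_q_left(2)[OF A(1)])
  \<comment> \<open>The two squares share their coordinates, so one correction serves both.\<close>
  with B(11) have "br p2' p2' = q b 0 0 0" by auto
  from that[OF pj' B(1-7) refl B(8-10) b' this] show ?thesis .
qed

section \<open>The basis of L and the remaining brackets\<close>

lemma incl_expand: "\<psi> m = (\<Sum>i\<in>UNIV. m $ i *\<^sub>R \<psi> (axis i 1))"
  by (simp add: UNIV_mod_ix incl_axis incl_eq_q[of m])

text \<open>Exactness: lifts of a basis of the quotient together with a basis of the kernel form a
  basis of L.\<close>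

lemma is_basis_lifts:
  assumes D: "\<And>i. \<pi> (e (D i)) = axis i 1" and M: "\<And>i. e (M i) = \<psi> (axis i 1)"
  shows "is_basis e"
proof -
  have proj_comb: "\<pi> (\<Sum>i\<in>UNIV. c i *\<^sub>R e (D i)) = (\<chi> i. c i)" for c
    by (simp add: linear_sum[OF linear_proj] proj_simps D vec_eq_iff axis_def if_distrib cong: if_cong)
  have incl_comb: "(\<Sum>i\<in>UNIV. c i *\<^sub>R e (M i)) = \<psi> (\<chi> i. c i)" for c
    by (simp add: incl_expand[of "\<chi> i. c i"] M)
  have incl0: "\<pi> (\<psi> m) = 0" for m using range_incl by blast
  have fin: "finite (UNIV :: leib_ix set)" by (simp add: UNIV_leib_ix)
  have zero: "c i = 0" if s: "(\<Sum>i\<in>UNIV. c i *\<^sub>R e i) = 0" for c i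
  proof -
    have s': "(\<Sum>i\<in>UNIV. c (D i) *\<^sub>R e (D i)) + \<psi> (\<chi> i. c (M i)) = 0"
      using s by (simp add: sum_leib_ix incl_comb)
    \<comment> \<open>Applying \<open>\<pi>\<close> kills the part in I; once the other coefficients
      vanish, injectivity of \<open>\<psi>\<close> settles that part.\<close>
    have "(\<chi> i. c (D i)) = 0"
      using arg_cong[OF s', of \<pi>] by (simp add: proj_simps incl0 proj_comb)
    then have cD: "c (D k) = 0" for k by (simp add: vec_eq_iff)
    with s' have "\<psi> (\<chi> i. c (M i)) = \<psi> 0" by (simp add: linear_0[OF linear_incl])
    then have "(\<chi> i. c (M i)) = 0" using inj_incl by (simp only: inj_eq)
    then have "c (M k) = 0" for k by (simp add: vec_eq_iff)
    with cD show ?thesis by (cases i) auto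
  qed
  have "x \<in> span (range e)" for x
  proof -
    let ?y = "\<Sum>i\<in>UNIV. \<pi> x $ i *\<^sub>R e (D i)"
    have "\<pi> (x - ?y) = 0" by (simp add: proj_simps proj_comb vec_eq_iff)
    then obtain m where m: "x - ?y = \<psi> m" using range_incl by blast
    have "x = ?y + (\<Sum>i\<in>UNIV. m $ i *\<^sub>R e (M i))"
      unfolding M incl_expand[symmetric] m[symmetric] by simp
    also have "\<dots> \<in> span (range e)"
      by (intro span_add span_sum span_scale span_base) auto
    finally show ?thesis .
  qed
  then show ?thesis
    using independent_family_if_scalars_zero[of UNIV e] fin zero
    unfolding is_basis_def by blast
qed

lemma normal_form:
  "\<exists>(\<alpha>1::real) (\<alpha>2::real) (e :: leib_ix \<Rightarrow> 'a).
     is_basis e \<and> (\<forall>i j. br (e i) (e j) = leib_table \<alpha>1 \<alpha>2 e i j)"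
proof -
  obtain j p1 p2 t \<alpha> \<beta> where
    \<pi>: "\<pi> j = axis J 1" "\<pi> p1 = axis P1 1" "\<pi> p2 = axis P2 1" "\<pi> t = axis T 1"
    and B: "br j p1 = p2" "br j p2 = - p1" "br p1 j = - p2" "br p2 j = p1"
    "br p1 p2 = t" "br p2 p1 = - t" "br t j = 0" "br j j = q 0 0 0 \<alpha>"
    "br p1 p1 = q \<beta> 0 0 0" "br p2 p2 = q \<beta> 0 0 0"
    by (rule normalized_lifts)
  note act = br_q_left(1)[OF \<pi>(1)] br_q_left(2)[OF \<pi>(2)] br_q_left(3)[OF \<pi>(3)] br_q_left(4)[OF \<pi>(4)]
  have jt: "br j t = q (2 * \<beta>) 0 0 0"
    using leibniz[of j p1 p2] by (simp add: B br_simps)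
  have "\<pi> (br p1 t) = 0" "\<pi> (br t p2) = 0"
    using \<pi> by (simp_all add: proj_br diamond_table_def)
  \<comment> \<open>Membership of \<open>[p1, t]\<close> in I is all that is needed below: it makes
    \<open>[j, [p1, t]]\<close> vanish.\<close>
  then obtain k1 k2 k3 k4 r1 r2 r3 r4
    where k: "br p1 t = q k1 k2 k3 k4" and r: "br t p2 = q r1 r2 r3 r4"
    by (metis kernelE)
  have p2t: "br p2 t = q 0 (2 * \<beta>) 0 0"
    using leibniz[of j p1 t] by (simp add: B jt k act)
  \<comment> \<open>The identity reads \<open>[p2, t] = - [t, p2] - \<beta> X2\<close>, whence the
    coefficient \<open>- (2 + 1)\<close>.\<close>
  have tp2: "br t p2 = q 0 (- 3 * \<beta>) 0 0"
    using leibniz[of p2 p1 p2] by (simp add: B p2t r act br_simps algebra_simps)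
  \<comment> \<open>Since \<open>[t, j] = 0\<close>, the value of \<open>[t, p2]\<close> is carried
    to \<open>[t, p1]\<close> by the rotation that J induces on I.\<close>
  have tp1: "br t p1 = q 0 0 (3 * \<beta>) 0"
    using leibniz[of t j p2] by (simp add: B tp2 act br_simps minus_equation_iff[of "br t p1"])
  \<comment> \<open>The coefficient is \<open>1 - 3\<close>, from
    \<open>[[p1, p1], p2] = \<beta> X3\<close> and \<open>[t, p1]\<close>.\<close>
  have p1t: "br p1 t = q 0 0 (- 2 * \<beta>) 0"
    using leibniz[of p1 p1 p2] by (simp add: B tp1 act)
  \<comment> \<open>Both terms vanish because \<open>[X3, P2]\<close> and \<open>[X2, P1]\<close>
    are zero.\<close>
  have tt: "br t t = 0"
    using leibniz[of t p1 p2] by (simp add: B tp1 tp2 act)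
  define e where "e i = (case i of D k \<Rightarrow> (case k of J \<Rightarrow> j | P1 \<Rightarrow> p1 | P2 \<Rightarrow> p2 | T \<Rightarrow> t)
     | M k \<Rightarrow> \<psi> (axis k 1))" for i
  have e: "e (D J) = j" "e (D P1) = p1" "e (D P2) = p2" "e (D T) = t"
    "e (M X1) = q 1 0 0 0" "e (M X2) = q 0 1 0 0" "e (M X3) = q 0 0 1 0" "e (M X4) = q 0 0 0 1"
    by (simp_all add: e_def incl_axis)
  have "is_basis e"
  proof (rule is_basis_lifts)
    show "\<pi> (e (D i)) = axis i 1" for i by (cases i) (simp_all add: e \<pi>)
  qed (simp add: e_def)
  moreover have "br (e i) (e k) = leib_table \<alpha> \<beta> e i k" for i k
  proof (cases i)
    case (D i')
    then show ?thesis
    proof (cases k)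
      case (D k')
      with \<open>i = D i'\<close> show ?thesis
        by (cases i'; cases k') (simp_all add: leib_table_def e B jt p1t p2t tp1 tp2 tt)
    next
      case (M k')
      with \<open>i = D i'\<close> show ?thesis
        by (cases i'; cases k') (simp_all add: leib_table_def e)
    qed
  next
    case (M i')
    then show ?thesis
    proof (cases k)
      case (D k')
      with \<open>i = M i'\<close> show ?thesis
        by (cases i'; cases k') (simp_all add: leib_table_def e act)
    next
      case (M k')
      with \<open>i = M i'\<close> show ?thesis
        by (cases i'; cases k') (simp_all add: leib_table_def e)
    qed
  qed
  ultimately show ?thesis by blast
qed

end

section \<open>Passage from cosets to the extension\<close>

theorem lemma3:
  fixes br :: "'a::real_vector \<Rightarrow> 'a \<Rightarrow> 'a"
    and \<phi> :: "'a set \<Rightarrow> diamond"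
    and \<psi> :: "diamond_mod \<Rightarrow> 'a"
  assumes "leibniz_algebra br"
    and "quot_algebra_iso br (squares_ideal br) diamond_bracket \<phi>"
    and "diamond_module_iso br (squares_ideal br) \<phi> \<psi>"
  shows "\<exists>(\<alpha>1::real) (\<alpha>2::real) (e :: leib_ix \<Rightarrow> 'a).
           is_basis e \<and> (\<forall>i j. br (e i) (e j) = leib_table \<alpha>1 \<alpha>2 e i j)"
proof -
  define S where "S = squares_ideal br"
  \<comment> \<open>The quotient map followed by the isomorphism \<open>\<phi>\<close>; injectivity
    of \<open>\<phi>\<close> on cosets makes its kernel exactly \<open>S\<close>.\<close>
  define \<pi> where "\<pi> x = \<phi> (coset S x)" for x
  have bil: "bilinear br" using assms(1) by (simp add: leibniz_algebra_def)
  have ideal: "leibniz_ideal br S" unfolding S_def by (rule leibniz_ideal_squares_ideal)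
  then have sub: "subspace S" by (simp add: leibniz_ideal_def)
  have bij: "bij_betw \<phi> (range (coset S)) UNIV"
    and add: "\<And>x y. \<phi> (quot_add S (coset S x) (coset S y)) = \<pi> x + \<pi> y"
    and scale: "\<And>c x. \<phi> (quot_scale S c (coset S x)) = c *\<^sub>R \<pi> x"
    and bracket: "\<And>x y. \<phi> (quot_bracket br S (coset S x) (coset S y)) = diamond_bracket (\<pi> x) (\<pi> y)"
    using assms(2) unfolding quot_algebra_iso_def S_def[symmetric] \<pi>_def by auto
  have mod: "linear \<psi>" "bij_betw \<psi> UNIV S" "\<And>m x. \<psi> (diamond_act m (\<pi> x)) = br (\<psi> m) x"
    using assms(3) unfolding diamond_module_iso_def S_def[symmetric] \<pi>_def by auto
  have lin: "linear \<pi>"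
  proof (rule linearI)
    show "\<pi> (x + y) = \<pi> x + \<pi> y" for x y
      using add[of x y] by (simp add: quot_add_coset[OF sub] \<pi>_def)
    show "\<pi> (c *\<^sub>R x) = c *\<^sub>R \<pi> x" for c x
      using scale[of c x] by (simp add: quot_scale_coset[OF sub] \<pi>_def)
  qed
  have "\<pi> x = 0 \<longleftrightarrow> x \<in> S" for x
  proof -
    have "\<pi> x = 0 \<longleftrightarrow> \<phi> (coset S x) = \<phi> (coset S 0)"
      using linear_0[OF lin] by (simp add: \<pi>_def)
    also have "\<dots> \<longleftrightarrow> coset S x = coset S 0"
      using bij by (auto simp: bij_betw_def inj_on_def)
    also have "\<dots> \<longleftrightarrow> x \<in> S"
    proof
      assume "coset S x = coset S 0"
      then show "x \<in> S" using coset_self[OF sub, of x] by (simp add: coset_def)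
    next
      assume x: "x \<in> S"
      show "coset S x = coset S 0"
      proof (intro set_eqI iffI)
        fix z assume "z \<in> coset S x"
        then show "z \<in> coset S 0" using x sub by (auto simp: coset_def subspace_add)
      next
        fix z assume "z \<in> coset S 0"
        then have "z - x \<in> S" using x sub by (auto simp: coset_def subspace_diff)
        then show "z \<in> coset S x" by (auto simp: coset_def intro!: exI[of _ "z - x"])
      qed
    qed
    finally show ?thesis .
  qed
  then have ker: "{x. \<pi> x = 0} = S" by blast
  interpret diamond_extension br \<pi> \<psi>
  proof (rule diamond_extension.intro)
    show "leibniz_algebra br" by fact
    show "linear \<pi>" by (rule lin)
    have "\<pi> ` UNIV = \<phi> ` range (coset S)" by (auto simp: \<pi>_def)
    then show "surj \<pi>" using bij by (simp add: bij_betw_def)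
    show "\<pi> (br x y) = diamond_bracket (\<pi> x) (\<pi> y)" for x y
      using bracket[of x y] by (simp add: quot_bracket_coset[OF bil ideal] \<pi>_def)
    show "linear \<psi>" "inj \<psi>" "range \<psi> = {x. \<pi> x = 0}"
      using mod(1,2) by (simp_all add: bij_betw_def ker)
    show "\<psi> (diamond_act m (\<pi> x)) = br (\<psi> m) x" for m x by (rule mod(3))
    show "br y (\<psi> m) = 0" for y m
    proof (rule squares_ideal_right_annihilator[OF assms(1)])
      show "\<psi> m \<in> squares_ideal br" using mod(2) by (auto simp: bij_betw_def S_def)
    qed
  qed
  show ?thesis by (rule normal_form)
qed

end
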